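(* Let $p$ be an odd prime, and write points of $(\mathbb Z_p^2)^2$ as $(k,\kappa)$ with $k=(k_0,k_1)$, $\kappa=(\kappa_0,\kappa_1)$. Define $\mathcal B_0=\{\{(k,\kappa):\kappa\in\mathbb Z_p^2\}:k\in\mathbb Z_p^2\}$; $\mathcal B_1=\{\{(k,Ak+b):k\in\mathbb Z_p^2\}:A\in\mathrm{Sym}_2(\mathbb Z_p),\ b\in\mathbb Z_p^2\}$; $\mathcal B_2=\{\{((c_0,k_1),(\kappa_0,ak_1+b)):k_1,\kappa_0\in\mathbb Z_p\}:a,b,c_0\in\mathbb Z_p\}$; $\mathcal B_3=\{\{((k_0,c_1),(ak_0+b,\kappa_1)):k_0,\kappa_1\in\mathbb Z_p\}:a,b,c_1\in\mathbb Z_p\}$; $\mathcal B_4=\{\{((k_0,\alpha k_0+\beta),(\kappa_0,(-1/\alpha)\kappa_0+ak_0+b)):k_0,\kappa_0\in\mathbb Z_p\}:\alpha,\beta,a,b\in\mathbb Z_p,\ \alpha\ne0\}$. Then $\widetilde{AG}(2,p^2)=\bigcup_{i=0}^4\mathcal B_i$ is a $(p^4,p^2,p+1)$-BIBD on the point set $(\mathbb Z_p^2)^2$.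
   Context: A $(v,k,\lambda)$-BIBD is a collection of $k$-element subsets (blocks) of a $v$-element point set such that every pair of distinct points lies in exactly $\lambda$ blocks. $\mathrm{Sym}_2(\mathbb Z_p)$ denotes symmetric $2\times2$ matrices over $\mathbb Z_p$. *)

theory Defs
  imports
    "HOL-Analysis.Finite_Cartesian_Product"
    "Berlekamp_Zassenhaus.Finite_Field"
begin

text \<open>The field of integers modulo \<open>p\<close> is the type \<open>'p mod_ring\<close>, where \<open>'p\<close> is an arbitrary
  type of prime cardinality \<open>p\<close>.\<close>

type_synonym 'p plane = "'p mod_ring ^ 2"
type_synonym 'p point = "'p plane \<times> 'p plane"

text \<open>The coordinates of \<open>k :: 'p plane\<close> are \<open>k $ 0\<close> and \<open>k $ 1\<close>. The index type \<open>2\<close> has just the two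
  elements \<open>0\<close> and \<open>1\<close> (and \<open>2 = 0\<close> in it), so the library function \<open>vector\<close>, which counts from
  \<open>1\<close>, would put the two coordinates in the opposite order.\<close>

definition pt :: "'a \<Rightarrow> 'a \<Rightarrow> 'a ^ 2" where
  "pt x0 x1 = (\<chi> i. if i = 0 then x0 else x1)"

lemma pt_nth [simp]: "pt x0 x1 $ 0 = x0" "pt x0 x1 $ 1 = x1"
  by (simp_all add: pt_def)

definition Sym2 :: "('a ^ 2 ^ 2) set" where
  "Sym2 = {A. transpose A = A}"

text \<open>The blocks of a design form a set rather than a multiset: there are no repeated blocks.\<close>

definition is_BIBD :: "'a set \<Rightarrow> 'a set set \<Rightarrow> nat \<Rightarrow> nat \<Rightarrow> nat \<Rightarrow> bool" where
  "is_BIBD V \<B> v k l \<longleftrightarrow>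
     finite V \<and> card V = v \<and>
     (\<forall>B\<in>\<B>. B \<subseteq> V \<and> card B = k) \<and>
     (\<forall>x\<in>V. \<forall>y\<in>V. x \<noteq> y \<longrightarrow> card {B \<in> \<B>. x \<in> B \<and> y \<in> B} = l)"

definition blocks0 :: "'p::prime_card point set set" where
  "blocks0 = {{(k, \<kappa>) | \<kappa>. \<kappa> \<in> UNIV} | k. k \<in> UNIV}"

definition blocks1 :: "'p::prime_card point set set" where
  "blocks1 = {{(k, A *v k + b) | k. k \<in> UNIV} | A b. A \<in> Sym2}"

definition blocks2 :: "'p::prime_card point set set" where
  "blocks2 = {{(pt c0 k1, pt \<kappa>0 (a * k1 + b)) | k1 \<kappa>0. True} | a b c0. True}"

definition blocks3 :: "'p::prime_card point set set" where
  "blocks3 = {{(pt k0 c1, pt (a * k0 + b) \<kappa>1) | k0 \<kappa>1. True} | a b c1. True}"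

definition blocks4 :: "'p::prime_card point set set" where
  "blocks4 = {{(pt k0 (\<alpha> * k0 + \<beta>), pt \<kappa>0 ((- 1 / \<alpha>) * \<kappa>0 + a * k0 + b)) | k0 \<kappa>0. True}
              | \<alpha> \<beta> a b. \<alpha> \<noteq> 0}"

definition AG_tilde :: "'p::prime_card point set set" where
  "AG_tilde = blocks0 \<union> blocks1 \<union> blocks2 \<union> blocks3 \<union> blocks4"

end

theory Submission
  imports Defs "HOL-Analysis.Cartesian_Space"
begin

text \<open>The blocks are the translates of the Lagrangian planes of the symplectic space \<open>F\<^sub>p\<^sup>4\<close>. The blocks
  through two points \<open>x \<noteq> y\<close> thus correspond to the Lagrangian planes containing \<open>v = y - x\<close>. Write
  \<open>v = (k, \<kappa>)\<close>. If \<open>k \<noteq> 0\<close>, these are the graphs of the \<open>p\<close> symmetric matrices \<open>A\<close> with \<open>A k = \<kappa>\<close>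
  together with exactly one plane that is neither vertical nor a graph. If \<open>k = 0\<close>, they are the
  vertical plane together with \<open>p\<close> planes of a single one of the three intermediate families.\<close>

section \<open>Coordinates in the plane and symmetric matrices\<close>

lemma forall_2_01: "(\<forall>i::2. P i) \<longleftrightarrow> P 0 \<and> P 1"
proof -
  have "i = 0 \<or> i = 1" for i :: 2
    using exhaust_2[of i] by auto
  then show ?thesis by metis
qed

lemma sum_2_01: "sum f (UNIV :: 2 set) = f 0 + f 1"
proof -
  have "(UNIV :: 2 set) = {0, 1}"
    using forall_2_01[of "\<lambda>i. i \<in> {0, 1}"] by auto
  then have "sum f (UNIV :: 2 set) = sum f {0, 1}" by (rule arg_cong)
  then show ?thesis by simp
qed

lemma vec2_eq_iff: "x = y \<longleftrightarrow> x $ 0 = y $ 0 \<and> x $ 1 = y $ 1" for x y :: "'a ^ 2"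
  by (simp add: vec_eq_iff forall_2_01)

lemma pt_eq_iff: "pt a b = pt c d \<longleftrightarrow> a = c \<and> b = d"
  by (simp add: vec2_eq_iff)

lemma point_cases:
  obtains k0 k1 m0 m1 where "v = (pt k0 k1, pt m0 m1)"
proof
  show "v = (pt (fst v $ 0) (fst v $ 1), pt (snd v $ 0) (snd v $ 1))"
    by (simp add: prod_eq_iff vec2_eq_iff)
qed

lemma point_set_eqI:
  assumes "\<And>k0 k1 m0 m1. (pt k0 k1, pt m0 m1) \<in> A \<longleftrightarrow> (pt k0 k1, pt m0 m1) \<in> B"
  shows "A = B"
proof (rule Set.set_eqI)
  show "v \<in> A \<longleftrightarrow> v \<in> B" for v
    by (rule point_cases[of v]) (simp add: assms)
qed

lemma Sym2_eq: "Sym2 = {pt (pt x y) (pt y z) | x y z. True}"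
proof
  show "Sym2 \<subseteq> {pt (pt x y) (pt y z) | x y z :: 'a. True}"
  proof
    fix A :: "'a ^ 2 ^ 2" assume "A \<in> Sym2"
    have "A $ 1 $ 0 = Finite_Cartesian_Product.transpose A $ 0 $ 1"
      by (simp add: Finite_Cartesian_Product.transpose_def)
    also have "\<dots> = A $ 0 $ 1"
      using \<open>A \<in> Sym2\<close> by (simp add: Sym2_def)
    finally have "A = pt (pt (A $ 0 $ 0) (A $ 0 $ 1)) (pt (A $ 0 $ 1) (A $ 1 $ 1))"
      by (simp add: vec2_eq_iff)
    then show "A \<in> {pt (pt x y) (pt y z) | x y z. True}" by blast
  qed
  show "{pt (pt x y) (pt y z) | x y z :: 'a. True} \<subseteq> Sym2"
    by (auto simp: Sym2_def Finite_Cartesian_Product.transpose_def vec2_eq_iff)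
qed

lemma pt_mult_vec:
  "pt (pt x y) (pt z w) *v k = pt (x * k $ 0 + y * k $ 1) (z * k $ 0 + w * k $ 1)"
  for k :: "'a::semiring_1 ^ 2"
  by (simp add: vec2_eq_iff matrix_vector_mult_def sum_2_01)

section \<open>The Lagrangian planes as linear subspaces\<close>

definition lag0 :: "(('a::field ^ 2) \<times> ('a ^ 2)) set" where
  "lag0 = {u. fst u $ 0 = 0 \<and> fst u $ 1 = 0}"

definition lag1 :: "'a \<Rightarrow> 'a \<Rightarrow> 'a \<Rightarrow> (('a::field ^ 2) \<times> ('a ^ 2)) set" where
  "lag1 x y z = {u. snd u $ 0 = x * fst u $ 0 + y * fst u $ 1 \<and>
                    snd u $ 1 = y * fst u $ 0 + z * fst u $ 1}"

definition lag2 :: "'a \<Rightarrow> (('a::field ^ 2) \<times> ('a ^ 2)) set" where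
  "lag2 a = {u. fst u $ 0 = 0 \<and> snd u $ 1 = a * fst u $ 1}"

definition lag3 :: "'a \<Rightarrow> (('a::field ^ 2) \<times> ('a ^ 2)) set" where
  "lag3 a = {u. fst u $ 1 = 0 \<and> snd u $ 0 = a * fst u $ 0}"

text \<open>For \<alpha> nonzero this is a plane over the line spanned by
  \<open>(1, \<alpha>)\<close>. Its vertical vectors satisfy \<open>m0 + \<alpha> * m1 = 0\<close>,
  so they annihilate that line, which explains the slope \<open>- 1 / \<alpha>\<close>.
  \<open>lag2\<close> and \<open>lag3\<close> are the analogues over the two coordinate
  axes.\<close>

definition lag4 :: "'a \<Rightarrow> 'a \<Rightarrow> (('a::field ^ 2) \<times> ('a ^ 2)) set" where
  "lag4 \<alpha> a = {u. fst u $ 1 = \<alpha> * fst u $ 0 \<and> snd u $ 1 = (- 1 / \<alpha>) * snd u $ 0 + a * fst u $ 0}"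

lemmas lag_defs = lag0_def lag1_def lag2_def lag3_def lag4_def

text \<open>Sorted by the projection to the \<open>k\<close> component: the origin for
  \<open>lag0\<close>, the whole plane for \<open>lag1\<close>, and a line for the other three, one
  family per kind of direction.\<close>

definition lagrangians :: "(('a::field ^ 2) \<times> ('a ^ 2)) set set" where
  "lagrangians = {lag0} \<union> {lag1 x y z | x y z. True} \<union> range lag2 \<union> range lag3
     \<union> {lag4 \<alpha> a | \<alpha> a. \<alpha> \<noteq> 0}"

lemma lagrangians_cases [consumes 1, case_names lag0 lag1 lag2 lag3 lag4]:
  assumes "L \<in> lagrangians"
  obtains "L = lag0" | x y z where "L = lag1 x y z" | a where "L = lag2 a"
    | a where "L = lag3 a" | \<alpha> a where "\<alpha> \<noteq> 0" "L = lag4 \<alpha> a"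
  using assms unfolding lagrangians_def by blast

text \<open>The defining equations are linear and homogeneous, so each plane is an additive
  subgroup.\<close>

lemma lagrangian_diff:
  assumes "L \<in> lagrangians" "u \<in> L" "v \<in> L"
  shows "u - v \<in> L"
  using assms
  by (cases rule: lagrangians_cases) (auto simp: lag_defs right_diff_distrib diff_divide_distrib)

lemma lagrangian_diff_cancel_right:
  assumes L: "L \<in> lagrangians" and v: "v \<in> L"
  shows "u - v \<in> L \<longleftrightarrow> u \<in> L"
proof
  assume "u - v \<in> L"
  \<comment> \<open>This is \<open>- v\<close>, written so that closure under differences
    applies.\<close>
  moreover have "v - v - v \<in> L"
    using lagrangian_diff[OF L] v by blast
  ultimately have "(u - v) - (v - v - v) \<in> L"
    using lagrangian_diff[OF L] by blast
  then show "u \<in> L" by simp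
qed (use lagrangian_diff[OF L] v in blast)

section \<open>The number of points of a plane\<close>

lemma card_range_prod:
  fixes f :: "'a \<Rightarrow> 'a \<Rightarrow> 'b"
  assumes "\<And>s t s' t'. f s t = f s' t' \<Longrightarrow> s = s' \<and> t = t'"
  shows "card {f s t | s t. True} = CARD('a) ^ 2"
proof -
  have "{f s t | s t. True} = range (case_prod f)" by auto
  moreover have "inj (case_prod f)"
    using assms by (auto simp: inj_def)
  ultimately show ?thesis by (simp add: card_image power2_eq_square)
qed

text \<open>In each plane two coordinates are free and determine the other two, as in the block
  families; reading off \<open>s\<close> and \<open>t\<close> makes the parametrisation
  injective.\<close>

lemma lag_param:
  "lag0 = {(pt 0 0, pt s t) | s t :: 'a::field. True}"
  "lag1 x y z = {(pt s t, pt (x * s + y * t) (y * s + z * t)) | s t :: 'a. True}"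
  "lag2 a = {(pt 0 s, pt t (a * s)) | s t :: 'a. True}"
  "lag3 a = {(pt s 0, pt (a * s) t) | s t :: 'a. True}"
  "lag4 \<alpha> a = {(pt s (\<alpha> * s), pt t ((- 1 / \<alpha>) * t + a * s)) | s t :: 'a. True}"
  by (rule point_set_eqI; auto simp: lag_defs pt_eq_iff)+

lemma card_lagrangian:
  assumes "L \<in> (lagrangians :: (('a::field ^ 2) \<times> ('a ^ 2)) set set)"
  shows "card L = CARD('a) ^ 2"
  using assms
proof (cases rule: lagrangians_cases)
  case lag0
  show ?thesis unfolding lag0 lag_param by (rule card_range_prod) (simp add: pt_eq_iff)
next
  case (lag1 x y z)
  show ?thesis unfolding lag1 lag_param by (rule card_range_prod) (simp add: pt_eq_iff)
next
  case (lag2 a)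
  show ?thesis unfolding lag2 lag_param by (rule card_range_prod) (simp add: pt_eq_iff)
next
  case (lag3 a)
  show ?thesis unfolding lag3 lag_param by (rule card_range_prod) (simp add: pt_eq_iff)
next
  case (lag4 \<alpha> a)
  show ?thesis unfolding lag4(2) lag_param by (rule card_range_prod) (simp add: pt_eq_iff)
qed

section \<open>Planes through a nonzero vector\<close>

lemma card_insert_range:
  assumes "inj f" "x \<notin> range f"
  shows "card (insert x (range (f :: 'a::finite \<Rightarrow> 'b))) = CARD('a) + 1"
  using assms by (simp add: card_image)

text \<open>In each case the planes through \<open>v\<close> are one exceptional plane together with
  an injective family indexed by the field.\<close>

lemma card_lagrangians_through:
  fixes v :: "('a::{field,finite} ^ 2) \<times> ('a ^ 2)"
  assumes "v \<noteq> 0"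
  shows "card {L \<in> lagrangians. v \<in> L} = CARD('a) + 1"
proof -
  obtain k0 k1 m0 m1 where v: "v = (pt k0 k1, pt m0 m1)"
    by (rule point_cases)
  have nz: "k0 \<noteq> 0 \<or> k1 \<noteq> 0 \<or> m0 \<noteq> 0 \<or> m1 \<noteq> 0"
    using assms by (auto simp: v vec2_eq_iff prod_eq_iff)
  have mem: "v \<in> lag0 \<longleftrightarrow> k0 = 0 \<and> k1 = 0"
    "v \<in> lag1 x y z \<longleftrightarrow> m0 = x * k0 + y * k1 \<and> m1 = y * k0 + z * k1"
    "v \<in> lag2 a \<longleftrightarrow> k0 = 0 \<and> m1 = a * k1"
    "v \<in> lag3 a \<longleftrightarrow> k1 = 0 \<and> m0 = a * k0"
    "v \<in> lag4 \<alpha> a \<longleftrightarrow> k1 = \<alpha> * k0 \<and> m1 = (- 1 / \<alpha>) * m0 + a * k0" for x y z \<alpha> a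
    by (simp_all add: v lag_defs)
  \<comment> \<open>A graph reveals its matrix on the two unit vectors, and its only vertical vector
    is zero.\<close>
  have test: "(pt 1 0, pt x y) \<in> lag1 x y z" "(pt 0 1, pt y z) \<in> lag1 x y z"
    "(pt 0 0, pt s t) \<in> lag1 x y z \<longleftrightarrow> s = 0 \<and> t = 0" for x y z s t :: 'a
    by (auto simp: lag_defs)
  have inj1: "lag1 x y z = lag1 x' y' z' \<longleftrightarrow> x = x' \<and> y = y' \<and> z = z'" for x y z x' y' z' :: 'a
  proof
    assume "lag1 x y z = lag1 x' y' z'"
    then have "(pt 1 0, pt x y) \<in> lag1 x' y' z'" "(pt 0 1, pt y z) \<in> lag1 x' y' z'"
      using test(1,2) by metis+
    then show "x = x' \<and> y = y' \<and> z = z'"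
      by (simp add: lag_defs)
  qed simp
  have ne_graph: "lag2 a \<noteq> lag1 x y z" "lag3 a \<noteq> lag1 x y z" "lag4 \<alpha> a \<noteq> lag1 x y z"
    for a \<alpha> x y z :: 'a
  proof -
    \<comment> \<open>Nonzero vertical vectors, which no graph contains.\<close>
    have "(pt 0 0, pt 1 0) \<in> lag2 a" "(pt 0 0, pt 0 1) \<in> lag3 a"
      "(pt 0 0, pt 1 (- 1 / \<alpha>)) \<in> lag4 \<alpha> a"
      by (simp_all add: lag_defs)
    then show "lag2 a \<noteq> lag1 x y z" "lag3 a \<noteq> lag1 x y z" "lag4 \<alpha> a \<noteq> lag1 x y z"
      using test(3)[of _ _ x y z] zero_neq_one by metis+
  qed
  have ne_vert: "lag0 \<noteq> lag2 a" "lag0 \<noteq> lag3 a" "lag0 \<noteq> lag4 \<alpha> a" for a \<alpha> :: 'a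
  proof -
    \<comment> \<open>Vectors with nonzero \<open>k\<close> component, which the vertical plane does
      not contain.\<close>
    have "(pt 0 1, pt 0 a) \<in> lag2 a" "(pt 0 1, pt 0 a) \<notin> lag0"
      "(pt 1 0, pt a 0) \<in> lag3 a" "(pt 1 0, pt a 0) \<notin> lag0"
      "(pt 1 \<alpha>, pt 0 a) \<in> lag4 \<alpha> a" "(pt 1 \<alpha>, pt 0 a) \<notin> lag0"
      by (simp_all add: lag_defs)
    then show "lag0 \<noteq> lag2 a" "lag0 \<noteq> lag3 a" "lag0 \<noteq> lag4 \<alpha> a" by metis+
  qed
  have inj: "inj (lag2 :: 'a \<Rightarrow> _)" "inj (lag3 :: 'a \<Rightarrow> _)" "inj (lag4 \<alpha>)" for \<alpha> :: 'a
  proof -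
    \<comment> \<open>Over a spanning vector of the projected line, the remaining coordinate
      recovers the parameter \<open>a\<close>.\<close>
    have "(pt 0 1, pt 0 b) \<in> lag2 a \<longleftrightarrow> a = b" "(pt 1 0, pt b 0) \<in> lag3 a \<longleftrightarrow> a = b"
      "(pt 1 \<alpha>, pt 0 b) \<in> lag4 \<alpha> a \<longleftrightarrow> a = b" for a b
      by (auto simp: lag_defs)
    then show "inj (lag2 :: 'a \<Rightarrow> _)" "inj (lag3 :: 'a \<Rightarrow> _)" "inj (lag4 \<alpha>)"
      unfolding inj_def by metis+
  qed
  \<comment> \<open>A vertical \<open>v\<close> lies in an intermediate plane exactly when
    \<open>(m0, m1)\<close> annihilates its line, and then for every \<open>a\<close>. If
    \<open>k\<close> is nonzero, the line must be the one spanned by \<open>k\<close>. The number in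
    a case name tells which intermediate family occurs.\<close>
  consider (vert2) "k0 = 0" "k1 = 0" "m1 = 0" "m0 \<noteq> 0"
    | (vert3) "k0 = 0" "k1 = 0" "m1 \<noteq> 0" "m0 = 0"
    | (vert4) "k0 = 0" "k1 = 0" "m1 \<noteq> 0" "m0 \<noteq> 0"
    | (graph2) "k0 = 0" "k1 \<noteq> 0" | (graph3) "k0 \<noteq> 0" "k1 = 0" | (graph4) "k0 \<noteq> 0" "k1 \<noteq> 0"
    using nz by blast
  then show ?thesis
  proof cases
    case vert2
    have "{L \<in> lagrangians. v \<in> L} = insert lag0 (range lag2)"
      using vert2 by (auto simp: mem lagrangians_def)
    moreover have "lag0 \<notin> range (lag2 :: 'a \<Rightarrow> _)" using ne_vert by blast
    ultimately show ?thesis by (simp only: card_insert_range inj not_False_eq_True)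
  next
    case vert3
    have "{L \<in> lagrangians. v \<in> L} = insert lag0 (range lag3)"
      using vert3 by (auto simp: mem lagrangians_def)
    moreover have "lag0 \<notin> range (lag3 :: 'a \<Rightarrow> _)" using ne_vert by blast
    ultimately show ?thesis by (simp only: card_insert_range inj not_False_eq_True)
  next
    case vert4
    \<comment> \<open>Only one slope is annihilated by \<open>(m0, m1)\<close>; it is nonzero
      because \<open>m0\<close> is. The parameter \<open>a\<close> stays free, as its coefficient
      \<open>k0\<close> vanishes.\<close>
    have "m1 = (- 1 / \<alpha>) * m0 \<longleftrightarrow> \<alpha> = - m0 / m1" if "\<alpha> \<noteq> 0" for \<alpha>
      using vert4 that by (auto simp: field_simps)
    then have "{L \<in> lagrangians. v \<in> L} = insert lag0 (range (lag4 (- m0 / m1)))"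
      using vert4 unfolding lagrangians_def by (auto simp: mem)
    moreover have "lag0 \<notin> range (lag4 (- m0 / m1))" using ne_vert by blast
    ultimately show ?thesis by (simp only: card_insert_range inj not_False_eq_True)
  next
    case graph2
    \<comment> \<open>With \<open>k0 = 0\<close> the second column of the matrix is forced, and the
      entry \<open>x\<close> is free.\<close>
    define f where "f x = lag1 x (m0 / k1) (m1 / k1)" for x
    have eq: "m0 = y * k1 \<longleftrightarrow> y = m0 / k1" "m1 = z * k1 \<longleftrightarrow> z = m1 / k1" for y z
      using graph2 by (auto simp: field_simps)
    have "{L \<in> lagrangians. v \<in> L} = insert (lag2 (m1 / k1)) (range f)"
      using graph2 eq unfolding lagrangians_def f_def by (auto simp: mem inj1)
    moreover have "lag2 (m1 / k1) \<notin> range f" using ne_graph by (auto simp: f_def)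
    moreover have "inj f" by (simp add: inj_def f_def inj1)
    ultimately show ?thesis by (simp only: card_insert_range not_False_eq_True)
  next
    case graph3
    \<comment> \<open>With \<open>k1 = 0\<close> the first column is forced, and the entry
      \<open>z\<close> is free.\<close>
    define f where "f z = lag1 (m0 / k0) (m1 / k0) z" for z
    have eq: "m0 = y * k0 \<longleftrightarrow> y = m0 / k0" "m1 = z * k0 \<longleftrightarrow> z = m1 / k0" for y z
      using graph3 by (auto simp: field_simps)
    have "{L \<in> lagrangians. v \<in> L} = insert (lag3 (m0 / k0)) (range f)"
      using graph3 eq unfolding lagrangians_def f_def by (auto simp: mem inj1)
    moreover have "lag3 (m0 / k0) \<notin> range f" using ne_graph by (auto simp: f_def)
    moreover have "inj f" by (simp add: inj_def f_def inj1)
    ultimately show ?thesis by (simp only: card_insert_range not_False_eq_True)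
  next
    case graph4
    \<comment> \<open>With both coordinates nonzero, any off-diagonal entry \<open>y\<close>
      determines the two diagonal entries.\<close>
    define f where "f y = lag1 ((m0 - y * k1) / k0) y ((m1 - y * k0) / k1)" for y
    \<comment> \<open>The slope of the line spanned by \<open>k\<close>; \<open>a\<close> then
      solves the remaining equation of \<open>lag4\<close>.\<close>
    define \<alpha> where "\<alpha> = k1 / k0"
    define a where "a = (m1 + m0 / \<alpha>) / k0"
    have \<alpha>: "\<alpha> \<noteq> 0" using graph4 by (simp add: \<alpha>_def)
    have eq1: "m0 = x * k0 + y * k1 \<and> m1 = y * k0 + z * k1 \<longleftrightarrow>
        x = (m0 - y * k1) / k0 \<and> z = (m1 - y * k0) / k1" for x y z
      using graph4 by (auto simp: eq_divide_eq eq_diff_eq add.commute)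
    have eq4: "k1 = \<alpha>' * k0 \<and> m1 = (- 1 / \<alpha>') * m0 + a' * k0 \<longleftrightarrow> \<alpha>' = \<alpha> \<and> a' = a" for \<alpha>' a'
    proof -
      have "k1 = \<alpha>' * k0 \<longleftrightarrow> \<alpha>' = \<alpha>"
        using graph4 by (auto simp: \<alpha>_def eq_divide_eq)
      moreover have "m1 = (- 1 / \<alpha>) * m0 + a' * k0 \<longleftrightarrow> a' = a"
        using graph4 by (auto simp: a_def eq_divide_eq)
      ultimately show ?thesis by blast
    qed
    have "{L \<in> lagrangians. v \<in> L} = insert (lag4 \<alpha> a) (range f)"
      using graph4 \<alpha> unfolding lagrangians_def f_def
      by (auto simp: mem(1,3,4) inj1 eq1[folded mem(2)] eq4[folded mem(5)])
    moreover have "lag4 \<alpha> a \<notin> range f" using ne_graph by (auto simp: f_def)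
    moreover have "inj f" by (simp add: inj_def f_def inj1)
    ultimately show ?thesis by (simp only: card_insert_range not_False_eq_True)
  qed
qed

section \<open>Translates of the planes\<close>

definition translate :: "'a \<Rightarrow> 'a set \<Rightarrow> ('a::ab_group_add) set" where
  "translate c L = {u. u - c \<in> L}"

lemma mem_translate: "u \<in> translate c L \<longleftrightarrow> u - c \<in> L"
  by (simp add: translate_def)

lemma translate_lag0:
  fixes c :: "('a::field ^ 2) \<times> ('a ^ 2)"
  shows "{(fst c, \<kappa>) | \<kappa>. \<kappa> \<in> UNIV} = translate c lag0"
  by (auto simp: translate_def lag_defs vec2_eq_iff)

text \<open>The offset \<open>b\<close> is the one for which the affine graph passes through
  \<open>c\<close>. The offsets in the next three lemmas arise in the same way.\<close>

lemma translate_lag1: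
  fixes c :: "('a::field ^ 2) \<times> ('a ^ 2)"
  assumes "b = snd c - pt (pt x y) (pt y z) *v fst c"
  shows "{(k, pt (pt x y) (pt y z) *v k + b) | k. k \<in> UNIV} = translate c (lag1 x y z)"
  by (auto simp: assms translate_def lag_defs pt_mult_vec vec2_eq_iff algebra_simps prod_eq_iff)

lemma translate_lag2:
  fixes c :: "('a::field ^ 2) \<times> ('a ^ 2)"
  assumes "c0 = fst c $ 0" "b = snd c $ 1 - a * fst c $ 1"
  shows "{(pt c0 k1, pt \<kappa>0 (a * k1 + b)) | k1 \<kappa>0. True} = translate c (lag2 a)"
  by (rule point_set_eqI) (auto simp: assms translate_def lag_defs pt_eq_iff algebra_simps)

lemma translate_lag3:
  fixes c :: "('a::field ^ 2) \<times> ('a ^ 2)"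
  assumes "c1 = fst c $ 1" "b = snd c $ 0 - a * fst c $ 0"
  shows "{(pt k0 c1, pt (a * k0 + b) \<kappa>1) | k0 \<kappa>1. True} = translate c (lag3 a)"
  by (rule point_set_eqI) (auto simp: assms translate_def lag_defs pt_eq_iff algebra_simps)

lemma translate_lag4:
  fixes c :: "('a::field ^ 2) \<times> ('a ^ 2)"
  assumes "\<beta> = fst c $ 1 - \<alpha> * fst c $ 0"
    "b = snd c $ 1 - (- 1 / \<alpha>) * snd c $ 0 - a * fst c $ 0"
  shows "{(pt k0 (\<alpha> * k0 + \<beta>), pt \<kappa>0 ((- 1 / \<alpha>) * \<kappa>0 + a * k0 + b)) | k0 \<kappa>0. True}
      = translate c (lag4 \<alpha> a)"
  by (rule point_set_eqI)
    (auto simp: assms translate_def lag_defs pt_eq_iff algebra_simps diff_divide_distrib)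

section \<open>The block families as families of translates\<close>

lemma blocks0_eq: "(blocks0 :: 'p::prime_card point set set) = {translate c lag0 | c. True}"
proof -
  have "blocks0 = {{(fst c, \<kappa>) | \<kappa>. \<kappa> \<in> UNIV} | c :: 'p point. True}"
    unfolding blocks0_def by auto
  then show ?thesis by (simp only: translate_lag0)
qed

lemma blocks1_eq:
  "(blocks1 :: 'p::prime_card point set set) = {translate c (lag1 x y z) | c x y z. True}"
proof -
  define M :: "_ \<Rightarrow> _ \<Rightarrow> _ \<Rightarrow> 'p mod_ring ^ 2 ^ 2" where
    "M x y z = pt (pt x y) (pt y z)" for x y z
  define F :: "_ \<Rightarrow> _ \<Rightarrow> 'p point set" where
    "F A b = {(k, A *v k + b) | k. k \<in> UNIV}" for A b
  \<comment> \<open>The base point is where the block meets \<open>k = 0\<close>. The converse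
    \<open>trans\<close> reads the offset off an arbitrary \<open>c\<close>.\<close>
  have block: "F (M x y z) b = translate (0, b) (lag1 x y z)" for x y z b
    unfolding F_def M_def
    by (rule translate_lag1) (simp add: matrix_vector_mult_def vec2_eq_iff)
  have trans: "translate c (lag1 x y z) = F (M x y z) (snd c - M x y z *v fst c)" for c x y z
    unfolding F_def M_def by (rule translate_lag1[symmetric]) simp
  have eq: "blocks1 = {F A b | A b. A \<in> Sym2}"
    unfolding blocks1_def F_def ..
  have sym: "Sym2 = {M x y z | x y z. True}"
    unfolding Sym2_eq M_def ..
  show ?thesis
    unfolding eq sym by (rule equalityI) (force simp: block, force simp: trans)
qed

lemma blocks2_eq:
  "(blocks2 :: 'p::prime_card point set set) = {translate c (lag2 a) | c a. True}"
proof -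
  define F :: "_ \<Rightarrow> _ \<Rightarrow> _ \<Rightarrow> 'p point set" where
    "F a b c0 = {(pt c0 k1, pt \<kappa>0 (a * k1 + b)) | k1 \<kappa>0. True}" for a b c0
  \<comment> \<open>The base point is the point of the block with both free parameters zero; the
    same choice serves the next two families.\<close>
  have block: "F a b c0 = translate (pt c0 0, pt 0 b) (lag2 a)" for a b c0
    unfolding F_def by (rule translate_lag2) simp_all
  have trans: "translate c (lag2 a) = F a (snd c $ 1 - a * fst c $ 1) (fst c $ 0)" for c a
    unfolding F_def by (rule translate_lag2[symmetric]) simp_all
  have eq: "blocks2 = {F a b c0 | a b c0. True}"
    unfolding blocks2_def F_def ..
  show ?thesis
    unfolding eq by (rule equalityI) (force simp: block, force simp: trans)
qed

lemma blocks3_eq: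
  "(blocks3 :: 'p::prime_card point set set) = {translate c (lag3 a) | c a. True}"
proof -
  define F :: "_ \<Rightarrow> _ \<Rightarrow> _ \<Rightarrow> 'p point set" where
    "F a b c1 = {(pt k0 c1, pt (a * k0 + b) \<kappa>1) | k0 \<kappa>1. True}" for a b c1
  have block: "F a b c1 = translate (pt 0 c1, pt b 0) (lag3 a)" for a b c1
    unfolding F_def by (rule translate_lag3) simp_all
  have trans: "translate c (lag3 a) = F a (snd c $ 0 - a * fst c $ 0) (fst c $ 1)" for c a
    unfolding F_def by (rule translate_lag3[symmetric]) simp_all
  have eq: "blocks3 = {F a b c1 | a b c1. True}"
    unfolding blocks3_def F_def ..
  show ?thesis
    unfolding eq by (rule equalityI) (force simp: block, force simp: trans)
qed

lemma blocks4_eq: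
  "(blocks4 :: 'p::prime_card point set set) = {translate c (lag4 \<alpha> a) | c \<alpha> a. \<alpha> \<noteq> 0}"
proof -
  define F :: "_ \<Rightarrow> _ \<Rightarrow> _ \<Rightarrow> _ \<Rightarrow> 'p point set" where
    "F \<alpha> \<beta> a b = {(pt k0 (\<alpha> * k0 + \<beta>), pt \<kappa>0 ((- 1 / \<alpha>) * \<kappa>0 + a * k0 + b)) | k0 \<kappa>0. True}"
    for \<alpha> \<beta> a b
  have block: "F \<alpha> \<beta> a b = translate (pt 0 \<beta>, pt 0 b) (lag4 \<alpha> a)" for \<alpha> \<beta> a b
    unfolding F_def by (rule translate_lag4) simp_all
  have trans: "translate c (lag4 \<alpha> a) = F \<alpha> (fst c $ 1 - \<alpha> * fst c $ 0) a
      (snd c $ 1 - (- 1 / \<alpha>) * snd c $ 0 - a * fst c $ 0)" for c \<alpha> a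
    unfolding F_def by (rule translate_lag4[symmetric]) simp_all
  have eq: "blocks4 = {F \<alpha> \<beta> a b | \<alpha> \<beta> a b. \<alpha> \<noteq> 0}"
    unfolding blocks4_def F_def ..
  show ?thesis
    unfolding eq by (rule equalityI) (force simp: block, force simp: trans)
qed

text \<open>Translation distributes over the union that defines \<open>lagrangians\<close>, and the
  five pieces match the five block families.\<close>

lemma AG_tilde_eq:
  "(AG_tilde :: 'p::prime_card point set set) = {translate c L | c L. L \<in> lagrangians}"
proof -
  have Un: "{translate c L | c L. L \<in> A \<union> B}
      = {translate c L | c L. L \<in> A} \<union> {translate c L | c L. L \<in> B}" for A B :: "'p point set set"
    by blast
  have families:
    "{translate c L | c L. L \<in> {lag0}} = {translate c lag0 | c :: 'p point. True}"
    "{translate c L | c L. L \<in> {lag1 x y z | x y z. True}}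
      = {translate c (lag1 x y z) | (c :: 'p point) x y z. True}"
    "{translate c L | c L. L \<in> range lag2} = {translate c (lag2 a) | (c :: 'p point) a. True}"
    "{translate c L | c L. L \<in> range lag3} = {translate c (lag3 a) | (c :: 'p point) a. True}"
    "{translate c L | c L. L \<in> {lag4 \<alpha> a | \<alpha> a. \<alpha> \<noteq> 0}}
      = {translate c (lag4 \<alpha> a) | (c :: 'p point) \<alpha> a. \<alpha> \<noteq> 0}"
    by blast+
  show ?thesis
    unfolding AG_tilde_def blocks0_eq blocks1_eq blocks2_eq blocks3_eq blocks4_eq
      lagrangians_def Un families ..
qed

section \<open>The design parameters\<close>

theorem theorem5p8:
  fixes p :: nat
  assumes "prime p" and "odd p" and "CARD('p::prime_card) = p"
  shows "is_BIBD (UNIV :: 'p point set) AG_tilde (p ^ 4) (p ^ 2) (p + 1)"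
proof -
  have p: "CARD('p mod_ring) = p"
    using assms(3) by simp
  have "CARD('p point) = p ^ 4"
    by (simp add: assms(3) card_cartesian_product flip: UNIV_Times_UNIV)
  moreover have "card B = p ^ 2" if "B \<in> AG_tilde" for B :: "'p point set"
  proof -
    from that obtain c L where B: "B = translate c L" and L: "L \<in> lagrangians"
      unfolding AG_tilde_eq by blast
    have "bij_betw (\<lambda>u. u - c) B L"
      by (rule bij_betwI[where g = "\<lambda>w. w + c"]) (auto simp: B mem_translate)
    then show ?thesis
      using card_lagrangian[OF L] p by (simp add: bij_betw_same_card)
  qed
  moreover have "card {B \<in> AG_tilde. x \<in> B \<and> y \<in> B} = p + 1" if "x \<noteq> y" for x y :: "'p point"
  proof -
    \<comment> \<open>A block through \<open>x\<close> can be rebased at \<open>x\<close>, so it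
      contains \<open>y\<close> exactly when its plane contains \<open>y - x\<close>.\<close>
    have "{B \<in> AG_tilde. x \<in> B \<and> y \<in> B}
        = translate x ` {L \<in> lagrangians. y - x \<in> L}" (is "?l = ?r")
    proof
      show "?l \<subseteq> ?r"
      proof
        fix B assume "B \<in> ?l"
        then obtain c L where B: "B = translate c L" and L: "L \<in> lagrangians"
          and x: "x - c \<in> L" and y: "y - c \<in> L"
          by (auto simp: AG_tilde_eq mem_translate)
        \<comment> \<open>Since \<open>x - c\<close> lies in \<open>L\<close>, the base points
          \<open>c\<close> and \<open>x\<close> give the same coset.\<close>
        have shift: "u - c \<in> L \<longleftrightarrow> u - x \<in> L" for u
          using lagrangian_diff_cancel_right[OF L x, of "u - c"] by simp
        then have "B = translate x L"
          by (simp add: B translate_def)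
        then show "B \<in> ?r"
          using L y shift by blast
      qed
      show "?r \<subseteq> ?l"
      proof
        fix B assume "B \<in> ?r"
        then obtain L where B: "B = translate x L" and L: "L \<in> lagrangians" and y: "y - x \<in> L"
          by blast
        \<comment> \<open>Zero is obtained as the difference of \<open>y - x\<close> with
          itself.\<close>
        have "x - x \<in> L"
          using lagrangian_diff[OF L y y] by simp
        then have "x \<in> B" "y \<in> B"
          using y by (simp_all add: B mem_translate)
        moreover have "B \<in> AG_tilde"
          unfolding AG_tilde_eq using B L by blast
        ultimately show "B \<in> ?l" by blast
      qed
    qed
    \<comment> \<open>Translating back recovers the plane, so distinct planes through
      \<open>y - x\<close> give distinct blocks.\<close>
    moreover have "inj (translate x)"
      by (rule inj_on_inverseI[where g = "\<lambda>B. {w. w + x \<in> B}"]) (simp add: translate_def)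
    ultimately have "card {B \<in> AG_tilde. x \<in> B \<and> y \<in> B} = card {L \<in> lagrangians. y - x \<in> L}"
      by (simp add: card_image inj_on_subset)
    also have "\<dots> = p + 1"
      using card_lagrangians_through[of "y - x"] that p by simp
    finally show ?thesis .
  qed
  ultimately show ?thesis
    by (simp add: is_BIBD_def)
qed

end
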